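(* Let $0<\mu\leq T$ be constants and let $(A,B)$ be a controllable pair of real matrices of size $n\times n$ and $n\times m$ respectively. Let $t>0$. Then the system $\dot x = Ax+\alpha(\cdot)Bu$ is controllable in time $t$ for $\mathcal{G}(T,\mu)$ if and only if $t>T-\mu$.
   Context: For positive constants $\mu\leq T$, a $(T,\mu)$-signal is a measurable function $\alpha:\mathbb{R}_{\geq 0}\to[0,1]$ such that $\int_s^{s+T}\alpha(\tau)\,d\tau\geq\mu$ for every $s\geq 0$; $\mathcal{G}(T,\mu)$ denotes the set of all $(T,\mu)$-signals. The system $\dot x=Ax+\alpha Bu$ ($x\in\mathbb{R}^n$, $u\in\mathbb{R}^m$) is said to be controllable in time $t>0$ for $\mathcal{G}(T,\mu)$ if, for every $\alpha\in\mathcal{G}(T,\mu)$, the time-varying linear control system $\dot x(s)=Ax(s)+\alpha(s)Bu(s)$ is completely controllable in time $t$, i.e. for all $x_0,x_1\in\mathbb{R}^n$ there is an admissible control $u$ on $[0,t]$ steering $x(0)=x_0$ to $x(t)=x_1$. The pair $(A,B)$ is controllable in the usual (Kalman) sense. *)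

theory Defs
  imports "HOL-Analysis.Analysis"
begin

text \<open>
  Signals, controls and trajectories are total functions of a real time variable; only their
  values at times in \<open>[0, \<infinity>)\<close>, respectively \<open>[0, t]\<close>, matter.
\<close>

definition pe_signals :: "real \<Rightarrow> real \<Rightarrow> (real \<Rightarrow> real) set" where
  "pe_signals T \<mu> =
     {\<alpha>. set_borel_measurable lebesgue {0..} \<alpha> \<and>
         (\<forall>s\<ge>0. \<alpha> s \<in> {0..1}) \<and>
         (\<forall>s\<ge>0. (LINT \<tau>:{s..s+T}|lebesgue. \<alpha> \<tau>) \<ge> \<mu>)}"

text \<open>
  Kalman rank condition: the block matrix \<open>[B, AB, \<dots>, A^(n-1) B]\<close> has rank \<open>n\<close>, its rank being
  the dimension spanned by the columns of all the blocks. Powers of \<open>A\<close> are iterated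
  matrix products, since \<open>^\<close> on this type is the componentwise power.
\<close>

definition controllable_pair :: "real^'n^'n \<Rightarrow> real^'m^'n \<Rightarrow> bool" where
  "controllable_pair A B \<longleftrightarrow>
     dim (\<Union>k<CARD('n). columns (((\<lambda>M. A ** M) ^^ k) B)) = CARD('n)"

text \<open>Admissible controls are of class \<open>L\<^sup>\<infinity>\<close> on \<open>[0, t]\<close>.\<close>

definition admissible_control :: "real \<Rightarrow> (real \<Rightarrow> real^'m) \<Rightarrow> bool" where
  "admissible_control t u \<longleftrightarrow>
     set_borel_measurable lebesgue {0..t} u \<and>
     (\<exists>C. AE s in lebesgue. s \<in> {0..t} \<longrightarrow> norm (u s) \<le> C)"

text \<open>
  Caratheodory solutions, in integral form: \<open>x\<close> is absolutely continuous on \<open>[0, t]\<close> and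
  satisfies \<open>x' = A x + \<alpha> B u\<close> almost everywhere.
\<close>

definition is_trajectory ::
  "real^'n^'n \<Rightarrow> real^'m^'n \<Rightarrow> (real \<Rightarrow> real) \<Rightarrow> real \<Rightarrow> (real \<Rightarrow> real^'m) \<Rightarrow> (real \<Rightarrow> real^'n) \<Rightarrow> bool"
where
  "is_trajectory A B \<alpha> t u x \<longleftrightarrow>
     set_integrable lebesgue {0..t} (\<lambda>\<tau>. A *v x \<tau> + \<alpha> \<tau> *\<^sub>R (B *v u \<tau>)) \<and>
     (\<forall>s\<in>{0..t}. x s = x 0 + (LINT \<tau>:{0..s}|lebesgue. A *v x \<tau> + \<alpha> \<tau> *\<^sub>R (B *v u \<tau>)))"

definition completely_controllable ::
  "real^'n^'n \<Rightarrow> real^'m^'n \<Rightarrow> (real \<Rightarrow> real) \<Rightarrow> real \<Rightarrow> bool" where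
  "completely_controllable A B \<alpha> t \<longleftrightarrow>
     (\<forall>x0 x1. \<exists>u x. admissible_control t u \<and> is_trajectory A B \<alpha> t u x \<and> x 0 = x0 \<and> x t = x1)"

definition controllable_for_pe_signals ::
  "real^'n^'n \<Rightarrow> real^'m^'n \<Rightarrow> real \<Rightarrow> real \<Rightarrow> real \<Rightarrow> bool" where
  "controllable_for_pe_signals A B T \<mu> t \<longleftrightarrow>
     (\<forall>\<alpha>\<in>pe_signals T \<mu>. completely_controllable A B \<alpha> t)"

end

theory Submission
  imports Defs
begin

text \<open>
  The signal that vanishes on \<open>[0, T - \<mu>]\<close> and equals \<open>1\<close> afterwards belongs to \<open>G(T, \<mu>)\<close>
  and leaves the system uncontrolled up to time \<open>T - \<mu>\<close>. Conversely, if \<open>t > T - \<mu>\<close>, then no signal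
  vanishes almost everywhere on \<open>[0, t]\<close>. If \<open>w\<close> is in the kernel of the Gramian
  \<open>\<integral>\<^sub>0\<^sup>t \<alpha>\<^sup>2 exp(-A s) B B\<^sup>T exp(-A\<^sup>T s) ds\<close>, then \<open>B\<^sup>T exp(-A\<^sup>T s) w\<close> has infinitely many zeros in \<open>[0, t]\<close>,
  so at an accumulation point of zeros all its derivatives vanish by Rolle's theorem, and the
  Kalman condition gives \<open>w = 0\<close>. Hence the Gramian is onto, and the control
  \<open>\<alpha> B\<^sup>T exp(-A\<^sup>T s) w\<close> steers \<open>x0\<close> to \<open>x1\<close> for a suitable \<open>w\<close>.
\<close>

section \<open>Matrix products as bounded bilinear maps, and the matrix exponential\<close>

lemma bounded_bilinear_matrix_vector_mult:
  "bounded_bilinear ((*v) :: real^'n^'m \<Rightarrow> real^'n \<Rightarrow> real^'m)"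
proof (subst bilinear_conv_bounded_bilinear[symmetric], unfold bilinear_def, intro conjI allI)
  show "linear ((*v) M)" for M :: "real^'n^'m"
    by (rule matrix_vector_mul_linear)
  show "linear (\<lambda>M. M *v v)" for v :: "real^'n"
    by (rule linearI) (simp_all add: matrix_vector_mult_add_rdistrib scaleR_matrix_vector_assoc)
qed

lemma bounded_bilinear_matrix_matrix_mult:
  "bounded_bilinear ((**) :: real^'n^'m \<Rightarrow> real^'k^'n \<Rightarrow> real^'k^'m)"
proof (subst bilinear_conv_bounded_bilinear[symmetric], unfold bilinear_def, intro conjI allI)
  show "linear ((**) M :: real^'k^'n \<Rightarrow> real^'k^'m)" for M :: "real^'n^'m"
    by (rule linearI)
      (simp_all add: vec_eq_iff matrix_matrix_mult_def sum.distrib sum_distrib_left ring_distribs mult_ac)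
  show "linear (\<lambda>M :: real^'n^'m. M ** N)" for N :: "real^'k^'n"
    by (rule linearI)
      (simp_all add: vec_eq_iff matrix_matrix_mult_def sum.distrib sum_distrib_left ring_distribs mult_ac)
qed

definition mpower :: "real^'n^'n \<Rightarrow> nat \<Rightarrow> real^'n^'n" where
  "mpower A k = ((\<lambda>M. A ** M) ^^ k) (mat 1)"

lemma mpower_0 [simp]: "mpower A 0 = mat 1"
  and mpower_Suc: "mpower A (Suc k) = A ** mpower A k"
  by (simp_all add: mpower_def)

lemma mpower_commute: "mpower A k ** A = A ** mpower A k"
  by (induction k) (simp_all add: mpower_Suc flip: matrix_mul_assoc)

text \<open>The matrix exponential exp(s A), defined entry by entry so that each entry is a real
  power series in \<open>s\<close>, to which termwise differentiation applies.\<close>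

definition mexp :: "real^'n^'n \<Rightarrow> real \<Rightarrow> real^'n^'n" where
  "mexp A s = (\<chi> i j. \<Sum>k. mpower A k $ i $ j / fact k * s ^ k)"

lemma mpower_entry_le:
  fixes A :: "real^'n^'n"
  obtains K where "\<And>k i j. \<bar>mpower A k $ i $ j\<bar> \<le> K ^ k"
proof
  \<comment> \<open>The sum of the absolute values of all entries dominates every absolute row sum,
    so each further factor \<open>A\<close> multiplies the bound by at most
    \<open>K\<close>.\<close>
  define K where "K = (\<Sum>i\<in>UNIV. \<Sum>l\<in>UNIV. \<bar>A $ i $ l\<bar>)"
  have row: "(\<Sum>l\<in>UNIV. \<bar>A $ i $ l\<bar>) \<le> K" for i
    unfolding K_def by (rule member_le_sum) (auto intro: sum_nonneg)
  show "\<bar>mpower A k $ i $ j\<bar> \<le> K ^ k" for k i j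
  proof (induction k arbitrary: i)
    case 0
    show ?case by (simp add: mat_def)
  next
    case (Suc k)
    have K0: "0 \<le> K" unfolding K_def by (intro sum_nonneg) auto
    have "\<bar>mpower A (Suc k) $ i $ j\<bar> \<le> (\<Sum>l\<in>UNIV. \<bar>A $ i $ l\<bar> * \<bar>mpower A k $ l $ j\<bar>)"
      unfolding mpower_Suc matrix_matrix_mult_def
      by (simp flip: abs_mult)
    also have "\<dots> \<le> (\<Sum>l\<in>UNIV. \<bar>A $ i $ l\<bar> * K ^ k)"
      by (intro sum_mono mult_left_mono Suc) auto
    also have "\<dots> \<le> K * K ^ k"
      unfolding sum_distrib_right[symmetric]
      by (intro mult_right_mono row) (simp add: K0)
    finally show ?case by simp
  qed
qed

lemma summable_mexp: "summable (\<lambda>k. mpower A k $ i $ j / fact k * s ^ k)"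
proof -
  obtain K where K: "\<And>k i j. \<bar>mpower A k $ i $ j\<bar> \<le> K ^ k"
    using mpower_entry_le by blast
  have "summable (\<lambda>k. (K * \<bar>s\<bar>) ^ k /\<^sub>R fact k)"
    by (rule summable_exp_generic)
  then show ?thesis
  proof (rule summable_comparison_test')
    fix k :: nat
    have "norm (mpower A k $ i $ j / fact k * s ^ k) = \<bar>mpower A k $ i $ j\<bar> * \<bar>s\<bar> ^ k / fact k"
      by (simp add: abs_mult power_abs)
    also have "\<dots> \<le> K ^ k * \<bar>s\<bar> ^ k / fact k"
      by (intro divide_right_mono mult_right_mono K) auto
    finally show "norm (mpower A k $ i $ j / fact k * s ^ k) \<le> (K * \<bar>s\<bar>) ^ k /\<^sub>R fact k"
      by (simp add: power_mult_distrib divide_simps mult.commute)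
  qed
qed

lemma mexp_0 [simp]: "mexp A 0 = mat 1"
  by (simp only: mexp_def vec_eq_iff vec_lambda_beta powser_zero) simp

text \<open>A finite sum of convergent series may be added termwise, so \<open>A\<close> moves
  inside the series. This form serves both the commutation with \<open>A\<close> and the
  identification of the derivative.\<close>

lemma matrix_mult_mexp_entry:
  "(A ** mexp A s) $ i $ j = (\<Sum>k. (A ** mpower A k) $ i $ j / fact k * s ^ k)"
proof -
  have "(A ** mexp A s) $ i $ j = (\<Sum>l\<in>UNIV. \<Sum>k. A $ i $ l * (mpower A k $ l $ j / fact k * s ^ k))"
    by (simp only: matrix_matrix_mult_def mexp_def vec_lambda_beta suminf_mult[OF summable_mexp])
  also have "\<dots> = (\<Sum>k. \<Sum>l\<in>UNIV. A $ i $ l * (mpower A k $ l $ j / fact k * s ^ k))"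
    by (rule suminf_sum[symmetric]) (intro summable_mult summable_mexp)
  also have "\<dots> = (\<Sum>k. (A ** mpower A k) $ i $ j / fact k * s ^ k)"
    unfolding matrix_matrix_mult_def by (simp add: sum_distrib_left sum_distrib_right sum_divide_distrib mult_ac)
  finally show ?thesis .
qed

lemma mexp_matrix_mult_entry:
  "(mexp A s ** A) $ i $ j = (\<Sum>k. (mpower A k ** A) $ i $ j / fact k * s ^ k)"
proof -
  have "(mexp A s ** A) $ i $ j = (\<Sum>l\<in>UNIV. \<Sum>k. mpower A k $ i $ l / fact k * s ^ k * A $ l $ j)"
    by (simp only: matrix_matrix_mult_def mexp_def vec_lambda_beta suminf_mult2[OF summable_mexp])
  also have "\<dots> = (\<Sum>k. \<Sum>l\<in>UNIV. mpower A k $ i $ l / fact k * s ^ k * A $ l $ j)"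
    by (rule suminf_sum[symmetric]) (intro summable_mult2 summable_mexp)
  also have "\<dots> = (\<Sum>k. (mpower A k ** A) $ i $ j / fact k * s ^ k)"
    unfolding matrix_matrix_mult_def by (simp add: sum_distrib_left sum_distrib_right sum_divide_distrib mult_ac)
  finally show ?thesis .
qed

lemma mexp_commute: "mexp A s ** A = A ** mexp A s"
  by (simp add: vec_eq_iff matrix_mult_mexp_entry mexp_matrix_mult_entry mpower_commute)

lemma mexp_entry_deriv:
  "((\<lambda>s. mexp A s $ i $ j) has_real_derivative (A ** mexp A s) $ i $ j) (at s)"
proof -
  have "((\<lambda>s. \<Sum>k. mpower A k $ i $ j / fact k * s ^ k) has_real_derivative
      (\<Sum>k. diffs (\<lambda>k. mpower A k $ i $ j / fact k) k * s ^ k)) (at s)"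
    by (rule termdiffs_strong_converges_everywhere) (rule summable_mexp)
  \<comment> \<open>Differentiation shifts the index and produces the factor k + 1, which cancels
    against \<open>fact (Suc k)\<close> and leaves one extra factor \<open>A\<close>.\<close>
  moreover have "diffs (\<lambda>k. mpower A k $ i $ j / fact k) k = (A ** mpower A k) $ i $ j / fact k" for k
    by (simp add: diffs_def mpower_Suc divide_simps del: of_nat_Suc)
  ultimately show ?thesis
    by (simp only: matrix_mult_mexp_entry) (simp only: mexp_def vec_lambda_beta)
qed

lemma mexp_deriv: "(mexp A has_vector_derivative A ** mexp A s) (at s within S)"
proof -
  have "((\<lambda>s. mexp A s $ i $ j) has_vector_derivative (A ** mexp A s) $ i $ j) (at s within S)" for i j
    using mexp_entry_deriv[of A i j s, THEN DERIV_subset, of S]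
    by (simp add: has_real_derivative_iff_has_vector_derivative)
  then show ?thesis
    unfolding has_vector_derivative_def
    by (subst has_derivative_componentwise_within)
      (auto simp: Basis_vec_def inner_axis has_vector_derivative_def)
qed

lemma continuous_on_mexp: "continuous_on S (mexp A)"
  by (rule continuous_on_vector_derivative) (rule mexp_deriv)

text \<open>The two terms of the derivative of the product cancel because \<open>A\<close> commutes
  with its exponential. The product is therefore constant, and its value at 0 is the
  identity.\<close>

lemma mexp_mult_minus: "mexp A s ** mexp (- A) s = mat 1"
proof -
  interpret bounded_bilinear "(**) :: real^'n^'n \<Rightarrow> real^'n^'n \<Rightarrow> real^'n^'n"
    by (rule bounded_bilinear_matrix_matrix_mult)
  have "((\<lambda>s. mexp A s ** mexp (- A) s) has_vector_derivative 0) (at s)" for s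
  proof -
    have "((\<lambda>s. mexp A s ** mexp (- A) s) has_vector_derivative
       mexp A s ** (- A ** mexp (- A) s) + (A ** mexp A s) ** mexp (- A) s) (at s)"
      by (intro has_vector_derivative mexp_deriv)
    also have "mexp A s ** (- A ** mexp (- A) s) = - ((mexp A s ** A) ** mexp (- A) s)"
      by (simp only: minus_left minus_right matrix_mul_assoc)
    finally show ?thesis by (simp add: mexp_commute)
  qed
  then obtain c where "\<And>s. mexp A s ** mexp (- A) s = c"
    using has_vector_derivative_zero_constant[of UNIV "\<lambda>s. mexp A s ** mexp (- A) s"] by auto
  from this[of s] this[of 0] show ?thesis by simp
qed

lemma mexp_minus_mult: "mexp (- A) s ** mexp A s = mat 1"
  using mexp_mult_minus[of "- A" s] by simp

section \<open>Real analysis: zeros of derivatives, and a product rule in integral form\<close>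

text \<open>By continuity \<xi> is itself a zero of \<open>f\<close>, so Rolle's theorem gives a
  zero of \<open>f'\<close> strictly between \<xi> and each nearby zero. Since the conclusion has
  the form of the hypothesis, the lemma iterates to derivatives of all orders.\<close>

lemma islimpt_zeros_deriv:
  fixes f f' :: "real \<Rightarrow> real"
  assumes der: "\<And>x. (f has_real_derivative f' x) (at x)"
    and lim: "\<xi> islimpt {x. f x = 0}"
  shows "\<xi> islimpt {x. f' x = 0}"
proof -
  have cont: "continuous_on UNIV f"
    using der DERIV_continuous_on by blast
  then have "closed {x. f x = 0}"
    by (intro closed_Collect_eq) auto
  with lim have f\<xi>: "f \<xi> = 0"
    by (auto simp: closed_limpt)
  show ?thesis
    unfolding islimpt_approachable
  proof (intro allI impI)
    fix e :: real assume "0 < e"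
    with lim obtain x where x: "f x = 0" "x \<noteq> \<xi>" "dist x \<xi> < e"
      unfolding islimpt_approachable by blast
    define a b where "a = min x \<xi>" and "b = max x \<xi>"
    have "\<exists>z. a < z \<and> z < b \<and> f' z = 0"
      by (rule Rolle_deriv[of a b f "\<lambda>x. (*) (f' x)", THEN exE])
        (use x f\<xi> cont der in \<open>auto simp: a_def b_def min_def max_def fun_eq_iff
           has_field_derivative_def intro: continuous_on_subset\<close>)
    with x show "\<exists>z\<in>{x. f' x = 0}. z \<noteq> \<xi> \<and> dist z \<xi> < e"
      by (auto simp: a_def b_def min_def max_def dist_real_def split: if_splits intro!: bexI)
  qed
qed

text \<open>Difference quotients are O(|y - x|), so the derivative exists and is zero at every
  point, including the one-sided derivatives at the ends.\<close>

lemma constant_if_quadratic_increments: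
  fixes z :: "real \<Rightarrow> 'a::real_normed_vector"
  assumes inc: "\<And>a b. 0 \<le> a \<Longrightarrow> a \<le> b \<Longrightarrow> b \<le> t \<Longrightarrow> norm (z b - z a) \<le> C * (b - a)\<^sup>2"
    and s: "s \<in> {0..t}"
  shows "z s = z 0"
proof -
  have *: "norm (z y - z x) \<le> \<bar>C\<bar> * (y - x)\<^sup>2" if "x \<in> {0..t}" "y \<in> {0..t}" for x y
  proof -
    have "norm (z y - z x) \<le> C * (y - x)\<^sup>2"
      using inc[of x y] inc[of y x] that by (cases "x \<le> y") (auto simp: norm_minus_commute power2_commute)
    also have "\<dots> \<le> \<bar>C\<bar> * (y - x)\<^sup>2"
      by (intro mult_right_mono) auto
    finally show ?thesis .
  qed
  have "(z has_vector_derivative 0) (at x within {0..t})" if x: "x \<in> {0..t}" for x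
    unfolding has_vector_derivative_def has_derivative_within_alt
  proof (intro conjI allI impI)
    fix e :: real assume "0 < e"
    \<comment> \<open>Within this distance |C| |y - x| is at most \<open>e\<close>; the summand 1
      keeps the divisor positive when C = 0.\<close>
    define d where "d = e / (\<bar>C\<bar> + 1)"
    have "0 < d" using \<open>0 < e\<close> by (simp add: d_def)
    moreover have "norm (z y - z x - (y - x) *\<^sub>R 0) \<le> e * norm (y - x)"
      if y: "y \<in> {0..t}" "norm (y - x) < d" for y
    proof -
      have "\<bar>C\<bar> * \<bar>y - x\<bar> \<le> (\<bar>C\<bar> + 1) * d"
        using y by (intro mult_mono) auto
      also have "\<dots> = e" by (simp add: d_def field_simps)
      finally have "\<bar>C\<bar> * \<bar>y - x\<bar> * \<bar>y - x\<bar> \<le> e * \<bar>y - x\<bar>"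
        by (intro mult_right_mono) auto
      then show ?thesis
        using *[OF x y(1)] by (simp add: power2_eq_square abs_mult_self mult.assoc)
    qed
    ultimately show "\<exists>d>0. \<forall>y\<in>{0..t}. norm (y - x) < d \<longrightarrow>
        norm (z y - z x - (y - x) *\<^sub>R 0) \<le> e * norm (y - x)"
      by blast
  qed (simp add: bounded_linear_scaleR_left)
  from has_vector_derivative_zero_constant[OF _ this] obtain c where "\<And>x. x \<in> {0..t} \<Longrightarrow> z x = c"
    by auto
  with s show ?thesis by auto
qed

text \<open>
  Since \<open>y\<close> is only Lipschitz, the difference of the two sides cannot be differentiated through
  the product rule at every time; instead its increments over \<open>[a, b]\<close> are \<open>O((b - a)\<^sup>2)\<close>, because
  \<open>E\<close> and \<open>y\<close> may be frozen at \<open>b\<close> and \<open>a\<close> with an error \<open>O(b - a)\<close> in the integrand.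
\<close>
lemma product_rule_integral:
  fixes E E' :: "real \<Rightarrow> 'a::banach" and f y :: "real \<Rightarrow> 'b::banach"
    and prod :: "'a \<Rightarrow> 'b \<Rightarrow> 'c::banach"
  assumes "bounded_bilinear prod"
    and E: "\<And>s. s \<in> {0..t} \<Longrightarrow> (E has_vector_derivative E' s) (at s within {0..t})"
    and E': "continuous_on {0..t} E'"
    and f: "f integrable_on {0..t}" and fC: "\<And>s. s \<in> {0..t} \<Longrightarrow> norm (f s) \<le> C"
    and Ef: "(\<lambda>s. prod (E s) (f s)) integrable_on {0..t}"
    and y: "\<And>s. s \<in> {0..t} \<Longrightarrow> y s = y0 + integral {0..s} f"
    and s: "s \<in> {0..t}"
  shows "prod (E s) (y s) = prod (E 0) y0 + integral {0..s} (\<lambda>\<tau>. prod (E' \<tau>) (y \<tau>) + prod (E \<tau>) (f \<tau>))"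
proof -
  interpret bounded_bilinear prod by fact
  have conty: "continuous_on {0..t} y"
    by (rule continuous_on_eq[where f = "\<lambda>s. y0 + integral {0..s} f"])
      (intro continuous_intros indefinite_integral_continuous_1 f, simp add: y)
  have contE: "continuous_on {0..t} E"
    by (rule continuous_on_vector_derivative) (rule E)
  obtain D where D: "0 \<le> D" "\<And>s. s \<in> {0..t} \<Longrightarrow> norm (E' s) \<le> D"
  proof -
    have "bounded (E' ` {0..t})"
      by (intro compact_imp_bounded compact_continuous_image E') auto
    then obtain D where "\<forall>x\<in>E' ` {0..t}. norm x \<le> D" by (auto simp: bounded_iff)
    then show ?thesis by (intro that[of "\<bar>D\<bar>"]) force+
  qed
  obtain K where K: "0 < K" "\<And>a b. norm (prod a b) \<le> norm a * norm b * K"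
    using pos_bounded by auto
  have C: "0 \<le> C" using fC[OF s] norm_ge_zero order_trans by blast
  define g where "g = (\<lambda>\<tau>. prod (E' \<tau>) (y \<tau>) + prod (E \<tau>) (f \<tau>))"
  have g: "g integrable_on {0..t}"
    unfolding g_def
    by (intro integrable_add Ef integrable_continuous_real continuous_on conty E')
  define z where "z s = prod (E s) (y s) - integral {0..s} g" for s
  have "z s = z 0"
  proof (rule constant_if_quadratic_increments[OF _ s])
    fix a b assume ab: "0 \<le> a" "a \<le> b" "b \<le> t"
    have sub: "{a..b} \<subseteq> {0..t}" using ab by auto
    note on = integrable_on_subinterval[OF _ sub]
    have comb: "integral {0..b} h - integral {0..a} h = integral {a..b} h"
      if "h integrable_on {0..t}" for h :: "real \<Rightarrow> 'd::banach"
      using Henstock_Kurzweil_Integration.integral_combine[of 0 a b h] ab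
        integrable_on_subinterval[OF that, of 0 b] by (simp add: algebra_simps)
    have yinc: "y \<tau> - y a = integral {a..\<tau>} f" if "\<tau> \<in> {a..b}" for \<tau>
      using Henstock_Kurzweil_Integration.integral_combine[of 0 a \<tau> f] ab that
        integrable_on_subinterval[OF f, of 0 \<tau>] by (simp add: y algebra_simps)
    have ybound: "norm (y \<tau> - y a) \<le> C * (b - a)" if "\<tau> \<in> {a..b}" for \<tau>
    proof -
      have "norm (y \<tau> - y a) \<le> C * (\<tau> - a)"
        unfolding yinc[OF that]
        using has_integral_bound[OF C, of f "integral {a..\<tau>} f" a \<tau>] that ab fC
          integrable_integral[OF integrable_on_subinterval[OF f, of a \<tau>]] by auto
      also have "\<dots> \<le> C * (b - a)" using that C by (intro mult_left_mono) auto
      finally show ?thesis .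
    qed
    have Einc: "(E' has_integral (E \<sigma> - E \<tau>)) {\<tau>..\<sigma>}" if "a \<le> \<tau>" "\<tau> \<le> \<sigma>" "\<sigma> \<le> b" for \<tau> \<sigma>
      by (rule fundamental_theorem_of_calculus)
        (use that ab in \<open>auto intro!: has_vector_derivative_within_subset[OF E]\<close>)
    have Ebound: "norm (E b - E \<tau>) \<le> D * (b - a)" if "\<tau> \<in> {a..b}" for \<tau>
    proof -
      have "norm (E b - E \<tau>) \<le> D * measure lborel (cbox \<tau> b)"
        using Einc[of \<tau> b] that ab D by (intro has_integral_bound[of D E']) auto
      also have "\<dots> \<le> D * (b - a)" using that D by (auto intro: mult_left_mono)
      finally show ?thesis .
    qed
    \<comment> \<open>Opposite endpoints are used for the two frozen factors: then E(b)(y(b) - y(a))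
      + (E(b) - E(a)) y(a) telescopes exactly to E(b) y(b) - E(a) y(a).\<close>
    have "((\<lambda>\<tau>. prod (E b) (f \<tau>)) has_integral prod (E b) (y b - y a)) {a..b}"
      using has_integral_linear[OF integrable_integral[OF on[OF f]] bounded_linear_right[of "E b"]]
        yinc[of b] ab by (simp add: o_def)
    moreover have "((\<lambda>\<tau>. prod (E' \<tau>) (y a)) has_integral prod (E b - E a) (y a)) {a..b}"
      using has_integral_linear[OF Einc[of a b] bounded_linear_left[of "y a"]] ab by (simp add: o_def)
    moreover have "(g has_integral (integral {0..b} g - integral {0..a} g)) {a..b}"
      unfolding comb[OF g] by (rule integrable_integral[OF on[OF g]])
    ultimately have "((\<lambda>\<tau>. prod (E b) (f \<tau>) + prod (E' \<tau>) (y a) - g \<tau>) has_integral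
        (prod (E b) (y b - y a) + prod (E b - E a) (y a) - (integral {0..b} g - integral {0..a} g))) {a..b}"
      by (intro has_integral_add has_integral_diff)
    also have "prod (E b) (y b - y a) + prod (E b - E a) (y a) - (integral {0..b} g - integral {0..a} g)
        = z b - z a"
      by (simp add: z_def diff_left diff_right)
    finally have "norm (z b - z a) \<le> (2 * D * C * K * (b - a)) * measure lborel (cbox a b)"
    unfolding box_real(2)[symmetric]
    proof (rule has_integral_bound[rotated])
      show "0 \<le> 2 * D * C * K * (b - a)" using D C K ab by simp
      fix \<tau> assume "\<tau> \<in> cbox a b"
      then have \<tau>: "\<tau> \<in> {a..b}" "\<tau> \<in> {0..t}" using sub by auto
      have "prod (E b) (f \<tau>) + prod (E' \<tau>) (y a) - g \<tau>
          = prod (E b - E \<tau>) (f \<tau>) - prod (E' \<tau>) (y \<tau> - y a)"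
        by (simp add: g_def diff_left diff_right)
      also have "norm \<dots> \<le> norm (E b - E \<tau>) * norm (f \<tau>) * K + norm (E' \<tau>) * norm (y \<tau> - y a) * K"
        by (rule order_trans[OF norm_triangle_ineq4 add_mono]) (rule K)+
      also have "\<dots> \<le> (D * (b - a)) * C * K + D * (C * (b - a)) * K"
        using \<tau> D C K ab
        by (intro add_mono mult_mono Ebound ybound fC) auto
      finally show "norm (prod (E b) (f \<tau>) + prod (E' \<tau>) (y a) - g \<tau>) \<le> 2 * D * C * K * (b - a)"
        by (simp add: algebra_simps)
    qed
    then show "norm (z b - z a) \<le> (2 * D * C * K) * (b - a)\<^sup>2"
      using ab by (simp add: power2_eq_square mult.assoc)
  qed
  then show ?thesis
    using y[of 0] s by (simp add: z_def g_def algebra_simps)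
qed

section \<open>The Kalman condition and the zeros of the adjoint output\<close>

text \<open>The rank condition makes the columns span the whole space, so \<open>w\<close> is
  orthogonal to itself.\<close>

lemma controllable_pair_orthogonal:
  fixes A :: "real^'n^'n" and B :: "real^'m^'n"
  assumes ctrl: "controllable_pair A B"
    and w: "\<And>k j. w \<bullet> column j (((\<lambda>M. A ** M) ^^ k) B) = 0"
  shows "w = 0"
proof -
  let ?S = "\<Union>k<CARD('n). columns (((\<lambda>M. A ** M) ^^ k) B)"
  have "span ?S = UNIV"
    using ctrl dim_eq_full[of ?S] by (simp add: controllable_pair_def)
  moreover have "orthogonal w v" if "v \<in> ?S" for v
    using that w by (auto simp: columns_def orthogonal_def)
  ultimately have "orthogonal w w"
    using orthogonal_to_span[of w ?S w] by auto
  then show ?thesis by (simp add: orthogonal_def)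
qed

lemma adjoint_infinitely_many_zeros:
  fixes A :: "real^'n^'n" and B :: "real^'m^'n"
  assumes ctrl: "controllable_pair A B"
    and inf: "infinite {s\<in>{0..t}. transpose (mexp (- A) s ** B) *v w = 0}"
  shows "w = 0"
proof -
  interpret mv: bounded_bilinear "(*v) :: real^'n^'n \<Rightarrow> real^'n \<Rightarrow> real^'n"
    by (rule bounded_bilinear_matrix_vector_mult)
  interpret mm: bounded_bilinear "(**) :: real^'n^'n \<Rightarrow> real^'n^'n \<Rightarrow> real^'n^'n"
    by (rule bounded_bilinear_matrix_matrix_mult)
  define P where "P k = ((\<lambda>M. A ** M) ^^ k) B" for k
  \<comment> \<open>Up to the sign (-1)^k, \<open>h k j\<close> is the k-th derivative of the j-th
    entry of the adjoint output B^T exp(-A^T s) w.\<close>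
  define h where "h k j s = w \<bullet> (mexp (- A) s *v column j (P k))" for k j s
  have col: "A *v column j (P k) = column j (P (Suc k))" for j k
    by (simp add: P_def column_def matrix_vector_mult_def matrix_matrix_mult_def)
  have deriv: "(h k j has_real_derivative - h (Suc k) j s) (at s)" for k j s
  proof -
    have "((\<lambda>s. mexp (- A) s *v column j (P k)) has_vector_derivative
        (- A ** mexp (- A) s) *v column j (P k)) (at s)"
      by (rule bounded_linear.has_vector_derivative[OF mv.bounded_linear_left mexp_deriv])
    then have "(h k j has_vector_derivative w \<bullet> ((- A ** mexp (- A) s) *v column j (P k))) (at s)"
      unfolding h_def by (rule bounded_linear.has_vector_derivative[OF bounded_linear_inner_right])
    \<comment> \<open>Commutation brings \<open>A\<close> to the right of the exponential, next to
      the column, where it turns \<open>P k\<close> into \<open>P (Suc k)\<close>.\<close>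
    also have "(- A ** mexp (- A) s) *v column j (P k) = - (mexp (- A) s *v column j (P (Suc k)))"
      unfolding mexp_commute[of "- A" s, symmetric]
      by (simp add: mm.minus_right mv.minus_left flip: col matrix_vector_mul_assoc)
    finally show ?thesis
      by (simp add: h_def[abs_def] has_real_derivative_iff_has_vector_derivative)
  qed
  obtain \<xi> where \<xi>: "\<xi> islimpt {s\<in>{0..t}. transpose (mexp (- A) s ** B) *v w = 0}"
    using Heine_Borel_imp_Bolzano_Weierstrass[OF compact_Icc inf] by blast
  have "\<xi> islimpt {s. h k j s = 0}" for k j
  proof (induction k)
    case 0
    have "h 0 j s = (transpose (mexp (- A) s ** B) *v w) $ j" for s
      by (simp add: h_def P_def inner_vec_def matrix_vector_mult_def transpose_def column_def
          matrix_matrix_mult_def mult.commute)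
    then show ?case
      by (intro islimpt_subset[OF \<xi>]) auto
  next
    case (Suc k)
    show ?case
      using islimpt_zeros_deriv[OF deriv Suc] by simp
  qed
  moreover have "closed {s. h k j s = 0}" for k j
    by (intro closed_Collect_eq continuous_on_const) (rule DERIV_continuous_on, rule deriv)
  ultimately have h0: "h k j \<xi> = 0" for k j
    by (auto simp: closed_limpt)
  \<comment> \<open>The Kalman condition is applied to the transported vector exp(-A^T \<xi>) w
    rather than to \<open>w\<close>; invertibility of the exponential then recovers
    \<open>w\<close>.\<close>
  have "w v* mexp (- A) \<xi> = 0"
    by (rule controllable_pair_orthogonal[OF ctrl])
      (use h0 in \<open>simp add: h_def P_def dot_lmul_matrix\<close>)
  \<comment> \<open>The two exponentials cancel, so this inner product is
    \<open>w \<bullet> w\<close>.\<close>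
  then have "w \<bullet> (mexp (- A) \<xi> *v (mexp A \<xi> *v w)) = 0"
    by (simp flip: dot_lmul_matrix)
  then show ?thesis
    by (simp add: matrix_vector_mul_assoc mexp_minus_mult)
qed

section \<open>The controllability Gramian\<close>

lemma absolutely_integrable_signal_scaleR:
  fixes g :: "real \<Rightarrow> 'a::euclidean_space"
  assumes \<beta>: "\<beta> \<in> borel_measurable (lebesgue_on {0..t})" "\<And>s. s \<in> {0..t} \<Longrightarrow> \<bar>\<beta> s\<bar> \<le> 1"
    and g: "continuous_on {0..t} g"
  shows "(\<lambda>s. \<beta> s *\<^sub>R g s) absolutely_integrable_on {0..t}"
proof (rule measurable_bounded_by_integrable_imp_absolutely_integrable)
  show "(\<lambda>s. \<beta> s *\<^sub>R g s) \<in> borel_measurable (lebesgue_on {0..t})"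
    by (intro borel_measurable_scaleR \<beta> continuous_imp_measurable_on_sets_lebesgue g) auto
  show "(\<lambda>s. norm (g s)) integrable_on {0..t}"
    by (intro integrable_continuous_real continuous_on_norm g)
  show "norm (\<beta> s *\<^sub>R g s) \<le> norm (g s)" if "s \<in> {0..t}" for s
    using \<beta>(2)[OF that] by (simp add: mult_left_le_one_le)
qed auto

lemma continuous_on_mexp_mult: "continuous_on S (\<lambda>s. mexp A s ** B)"
  by (rule bounded_bilinear.continuous_on[OF bounded_bilinear_matrix_matrix_mult continuous_on_mexp
        continuous_on_const])

lemma continuous_on_mexp_mult_adjoint:
  "continuous_on S (\<lambda>s. transpose (mexp A s ** B) *v w)"
  unfolding transpose_matrix_vector vector_matrix_mult_def
  by (intro continuous_on_vec_lambda continuous_on_sum continuous_on_mult continuous_on_const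
      continuous_on_component continuous_on_mexp_mult)

text \<open>The controllability Gramian pulled back to time 0, as an operator rather than a matrix.
  The signal is squared because the input matrix \<alpha>(s) B enters together with its
  transpose.\<close>

definition gramian :: "real^'n^'n \<Rightarrow> real^'m^'n \<Rightarrow> (real \<Rightarrow> real) \<Rightarrow> real \<Rightarrow> real^'n \<Rightarrow> real^'n" where
  "gramian A B \<alpha> t w = integral {0..t}
     (\<lambda>s. (\<alpha> s)\<^sup>2 *\<^sub>R ((mexp (- A) s ** B) *v (transpose (mexp (- A) s ** B) *v w)))"

lemma gramian_integrand:
  assumes \<alpha>: "\<alpha> \<in> borel_measurable (lebesgue_on {0..t})" "\<And>s. s \<in> {0..t} \<Longrightarrow> \<alpha> s \<in> {0..1}"
  shows "(\<lambda>s. (\<alpha> s)\<^sup>2 *\<^sub>R ((mexp (- A) s ** B) *v (transpose (mexp (- A) s ** B) *v w)))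
      absolutely_integrable_on {0..t}"
proof (rule absolutely_integrable_signal_scaleR)
  show "(\<lambda>s. (\<alpha> s)\<^sup>2) \<in> borel_measurable (lebesgue_on {0..t})"
    using \<alpha>(1) by measurable
  show "\<bar>(\<alpha> s)\<^sup>2\<bar> \<le> 1" if "s \<in> {0..t}" for s
    using \<alpha>(2)[OF that] by (simp add: power_le_one)
  show "continuous_on {0..t} (\<lambda>s. (mexp (- A) s ** B) *v (transpose (mexp (- A) s ** B) *v w))"
    by (intro bounded_bilinear.continuous_on[OF bounded_bilinear_matrix_vector_mult]
        continuous_on_mexp_mult continuous_on_mexp_mult_adjoint)
qed

lemma linear_gramian:
  assumes \<alpha>: "\<alpha> \<in> borel_measurable (lebesgue_on {0..t})" "\<And>s. s \<in> {0..t} \<Longrightarrow> \<alpha> s \<in> {0..1}"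
  shows "linear (gramian A B \<alpha> t)"
proof (rule linearI)
  have int: "(\<lambda>s. (\<alpha> s)\<^sup>2 *\<^sub>R ((mexp (- A) s ** B) *v (transpose (mexp (- A) s ** B) *v w)))
      integrable_on {0..t}" for w
    by (intro set_lebesgue_integral_eq_integral(1) gramian_integrand \<alpha>)
  show "gramian A B \<alpha> t (v + w) = gramian A B \<alpha> t v + gramian A B \<alpha> t w" for v w
    using Henstock_Kurzweil_Integration.integral_add[OF int[of v] int[of w]]
    by (simp add: gramian_def scaleR_add_right matrix_vector_right_distrib del: transpose_matrix_vector)
  show "gramian A B \<alpha> t (r *\<^sub>R w) = r *\<^sub>R gramian A B \<alpha> t w" for r w
    unfolding gramian_def integral_cmul[symmetric]
    by (simp add: matrix_vector_mult_scaleR mult.commute del: transpose_matrix_vector)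
qed

text \<open>In finite dimension injectivity suffices. For \<open>w\<close> in the kernel, the
  quadratic form \<open>w \<bullet> gramian A B \<alpha> t w\<close> is the integral of the squared
  norm of \<alpha> times the adjoint output, so this product vanishes almost everywhere. Were the
  zeros of the adjoint output finite in number, \<alpha> would vanish almost everywhere.\<close>

lemma gramian_surj:
  fixes A :: "real^'n^'n" and B :: "real^'m^'n"
  assumes ctrl: "controllable_pair A B"
    and \<alpha>: "\<alpha> \<in> borel_measurable (lebesgue_on {0..t})" "\<And>s. s \<in> {0..t} \<Longrightarrow> \<alpha> s \<in> {0..1}"
    and nz: "\<not> (AE s in lebesgue. s \<in> {0..t} \<longrightarrow> \<alpha> s = 0)"
  shows "surj (gramian A B \<alpha> t)"
proof (rule linear_inj_imp_surj[OF linear_gramian[OF \<alpha>]])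
  have "w = 0" if w: "gramian A B \<alpha> t w = 0" for w
  proof (rule adjoint_infinitely_many_zeros[OF ctrl], rule notI)
    define c where "c s = transpose (mexp (- A) s ** B) *v w" for s
    define Z where "Z = {s\<in>{0..t}. transpose (mexp (- A) s ** B) *v w = 0}"
    assume "finite {s\<in>{0..t}. transpose (mexp (- A) s ** B) *v w = 0}"
    then have "Z \<in> null_sets lebesgue"
      unfolding Z_def negligible_iff_null_sets[symmetric] by (rule negligible_finite)
    then have Z: "AE s in lebesgue. s \<notin> Z"
      by (rule AE_not_in)
    define q where "q s = (\<alpha> s)\<^sup>2 *\<^sub>R ((mexp (- A) s ** B) *v c s)" for s
    have q: "q absolutely_integrable_on {0..t}"
      unfolding q_def c_def by (rule gramian_integrand[OF \<alpha>])
    have wq: "w \<bullet> q s = (\<alpha> s * norm (c s))\<^sup>2" for s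
      by (simp add: q_def c_def power_mult_distrib power2_norm_eq_inner transpose_matrix_vector dot_lmul_matrix)
    \<comment> \<open>\<open>gramian\<close> is a Henstock-Kurzweil integral. The scalar integrand
      is moved to the Lebesgue integral, where a nonnegative function with integral zero vanishes
      almost everywhere.\<close>
    have "set_integrable lebesgue {0..t} (\<lambda>s. w \<bullet> q s)"
      using absolutely_integrable_linear[OF q bounded_linear_inner_right[of w]] by (simp add: o_def)
    moreover from this have "(LINT s:{0..t}|lebesgue. w \<bullet> q s) = w \<bullet> integral {0..t} q"
      using integral_linear[OF set_lebesgue_integral_eq_integral(1)[OF q] bounded_linear_inner_right[of w]]
      by (simp add: set_lebesgue_integral_eq_integral o_def)
    moreover have "integral {0..t} q = 0"
      using w by (simp add: gramian_def q_def[abs_def] c_def)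
    ultimately have "AE s in lebesgue. indicator {0..t} s *\<^sub>R (w \<bullet> q s) = 0"
      unfolding set_integrable_def set_lebesgue_integral_def
      by (subst integral_nonneg_eq_0_iff_AE[symmetric]) (auto simp: wq)
    with Z have "AE s in lebesgue. s \<in> {0..t} \<longrightarrow> \<alpha> s = 0"
      by eventually_elim (auto simp: wq Z_def c_def)
    with nz show False by blast
  qed
  then show "inj (gramian A B \<alpha> t)"
    using linear_injective_0[OF linear_gramian[OF \<alpha>]] by blast
qed

section \<open>Steering by means of the Gramian\<close>

lemma completely_controllableI:
  fixes A :: "real^'n^'n" and B :: "real^'m^'n"
  assumes ctrl: "controllable_pair A B" and t: "0 < t"
    and \<alpha>: "\<alpha> \<in> borel_measurable (lebesgue_on {0..t})" "\<And>s. s \<in> {0..t} \<Longrightarrow> \<alpha> s \<in> {0..1}"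
    and nz: "\<not> (AE s in lebesgue. s \<in> {0..t} \<longrightarrow> \<alpha> s = 0)"
  shows "completely_controllable A B \<alpha> t"
  unfolding completely_controllable_def
proof (intro allI)
  fix x0 x1
  note mv = bounded_bilinear_matrix_vector_mult
  \<comment> \<open>In the coordinates y(s) = exp(-A s) x(s) the drift disappears, and
    \<open>y\<close> must travel from \<open>x0\<close> to exp(-A t) \<open>x1\<close>. This
    displacement is prescribed as the value of the Gramian.\<close>
  obtain w where w: "gramian A B \<alpha> t w = mexp (- A) t *v x1 - x0"
    using gramian_surj[OF ctrl \<alpha> nz] by (metis surjD)
  define c where "c s = transpose (mexp (- A) s ** B) *v w" for s
  define u where "u s = \<alpha> s *\<^sub>R c s" for s
  define f where "f s = (\<alpha> s)\<^sup>2 *\<^sub>R ((mexp (- A) s ** B) *v c s)" for s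
  define y where "y s = x0 + integral {0..s} f" for s
  define x where "x s = mexp A s *v y s" for s
  have \<alpha>1: "\<bar>\<alpha> s\<bar> \<le> 1" and \<alpha>2: "(\<alpha> s)\<^sup>2 \<le> 1" if "s \<in> {0..t}" for s
    using \<alpha>(2)[OF that] by (simp_all add: power_le_one)
  have contc: "continuous_on {0..t} c"
    unfolding c_def by (rule continuous_on_mexp_mult_adjoint)
  have bnd: "\<exists>C. \<forall>s\<in>{0..t}. norm (g s) \<le> C" if "continuous_on {0..t} g" for g :: "real \<Rightarrow> real^'k"
    using compact_imp_bounded[OF compact_continuous_image[OF that compact_Icc]] by (auto simp: bounded_iff)
  have f: "f absolutely_integrable_on {0..t}"
    unfolding f_def c_def by (rule gramian_integrand[OF \<alpha>])
  note f_int = set_lebesgue_integral_eq_integral(1)[OF f]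
  \<comment> \<open>The exponentials cancel; one factor \<alpha> is absorbed in the control
    \<open>u\<close> and the other remains as the signal of the system.\<close>
  have Ef: "mexp A s *v f s = \<alpha> s *\<^sub>R (B *v u s)" for s
    by (simp add: f_def u_def matrix_vector_mult_scaleR matrix_vector_mul_assoc matrix_mul_assoc
        mexp_mult_minus power2_eq_square)
  have Bu: "(\<lambda>s. \<alpha> s *\<^sub>R (B *v u s)) absolutely_integrable_on {0..t}"
  proof -
    have "(\<lambda>s. (\<alpha> s)\<^sup>2 *\<^sub>R (B *v c s)) absolutely_integrable_on {0..t}"
    proof (rule absolutely_integrable_signal_scaleR)
      show "(\<lambda>s. (\<alpha> s)\<^sup>2) \<in> borel_measurable (lebesgue_on {0..t})"
        using \<alpha>(1) by measurable
      show "continuous_on {0..t} (\<lambda>s. B *v c s)"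
        by (intro bounded_bilinear.continuous_on[OF mv] contc continuous_on_const)
    qed (simp add: \<alpha>2)
    then show ?thesis
      by (simp add: u_def matrix_vector_mult_scaleR power2_eq_square)
  qed
  have conty: "continuous_on {0..t} y"
    unfolding y_def by (intro continuous_intros indefinite_integral_continuous_1 f_int)
  have contx: "continuous_on {0..t} x"
    unfolding x_def by (intro bounded_bilinear.continuous_on[OF mv] conty continuous_on_mexp)
  have Ax: "(\<lambda>s. A *v x s) absolutely_integrable_on {0..t}"
    by (intro absolutely_integrable_continuous_real bounded_bilinear.continuous_on[OF mv] contx
        continuous_on_const)
  note rhs = set_integral_add(1)[OF Ax Bu]
  have "admissible_control t u"
    unfolding admissible_control_def
  proof
    have "u \<in> borel_measurable (lebesgue_on {0..t})"
      unfolding u_def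
      by (intro borel_measurable_scaleR \<alpha> continuous_imp_measurable_on_sets_lebesgue contc) auto
    then show "set_borel_measurable lebesgue {0..t} u"
      by (simp add: set_borel_measurable_def borel_measurable_restrict_space_iff)
    obtain C where C: "\<And>s. s \<in> {0..t} \<Longrightarrow> norm (c s) \<le> C"
      using bnd[OF contc] by blast
    have "norm (u s) \<le> C" if "s \<in> {0..t}" for s
      using mult_mono[OF \<alpha>1[OF that] C[OF that]] by (simp add: u_def)
    then show "\<exists>C. AE s in lebesgue. s \<in> {0..t} \<longrightarrow> norm (u s) \<le> C"
      by (intro exI[of _ C] AE_I2) auto
  qed
  moreover have "is_trajectory A B \<alpha> t u x"
    unfolding is_trajectory_def
  proof (intro conjI ballI)
    fix s assume s: "s \<in> {0..t}"
    have contMc: "continuous_on {0..t} (\<lambda>s. (mexp (- A) s ** B) *v c s)"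
      by (intro bounded_bilinear.continuous_on[OF mv] contc continuous_on_mexp_mult)
    then obtain C where C: "\<And>s. s \<in> {0..t} \<Longrightarrow> norm ((mexp (- A) s ** B) *v c s) \<le> C"
      using bnd by blast
    have fC: "norm (f s) \<le> C" if "s \<in> {0..t}" for s
      using mult_mono[OF \<alpha>2[OF that] C[OF that]] by (simp add: f_def)
    \<comment> \<open>As \<alpha> is merely measurable, \<open>y\<close> need not be differentiable
      everywhere, and the integral product rule yields the Caratheodory equation directly.\<close>
    have "x s = mexp A 0 *v x0 + integral {0..s} (\<lambda>\<tau>. (A ** mexp A \<tau>) *v y \<tau> + mexp A \<tau> *v f \<tau>)"
      unfolding x_def
    proof (rule product_rule_integral[OF mv _ _ f_int fC _ _ s])
      show "(mexp A has_vector_derivative A ** mexp A s) (at s within {0..t})" for s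
        by (rule mexp_deriv)
      show "continuous_on {0..t} (\<lambda>s. A ** mexp A s)"
        by (intro bounded_bilinear.continuous_on[OF bounded_bilinear_matrix_matrix_mult]
            continuous_on_const continuous_on_mexp)
      show "(\<lambda>s. mexp A s *v f s) integrable_on {0..t}"
        unfolding Ef by (rule set_lebesgue_integral_eq_integral(1)[OF Bu])
    qed (simp_all add: y_def)
    also have "\<dots> = x 0 + integral {0..s} (\<lambda>\<tau>. A *v x \<tau> + \<alpha> \<tau> *\<^sub>R (B *v u \<tau>))"
      by (simp add: Ef x_def y_def matrix_vector_mul_assoc)
    also have "integral {0..s} (\<lambda>\<tau>. A *v x \<tau> + \<alpha> \<tau> *\<^sub>R (B *v u \<tau>))
        = (LINT \<tau>:{0..s}|lebesgue. A *v x \<tau> + \<alpha> \<tau> *\<^sub>R (B *v u \<tau>))"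
      by (rule set_lebesgue_integral_eq_integral(2)[symmetric],
          rule set_integrable_subset[OF rhs]) (use s in auto)
    finally show "x s = x 0 + (LINT \<tau>:{0..s}|lebesgue. A *v x \<tau> + \<alpha> \<tau> *\<^sub>R (B *v u \<tau>))" .
  qed (rule rhs)
  moreover have "x 0 = x0"
    by (simp add: x_def y_def)
  moreover have "x t = x1"
  proof -
    have "y t = mexp (- A) t *v x1"
      using w by (simp add: y_def f_def[abs_def] c_def gramian_def)
    then show ?thesis
      by (simp add: x_def matrix_vector_mul_assoc mexp_mult_minus)
  qed
  ultimately show "\<exists>u x. admissible_control t u \<and> is_trajectory A B \<alpha> t u x \<and> x 0 = x0 \<and> x t = x1"
    by blast
qed

section \<open>The system without input, and the threshold for signals\<close>

text \<open>Without input, exp(-A s) x(s) has derivative zero and so keeps its initial value 0; the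
  exponential is invertible.\<close>

lemma uncontrolled_trajectory_zero:
  assumes traj: "is_trajectory A B \<alpha> t u x" and \<alpha>: "\<And>s. s \<in> {0..t} \<Longrightarrow> \<alpha> s = 0"
    and x0: "x 0 = 0" and t: "0 < t"
  shows "x t = 0"
proof -
  interpret mm: bounded_bilinear "(**) :: real^'n^'n \<Rightarrow> real^'n^'n \<Rightarrow> real^'n^'n"
    by (rule bounded_bilinear_matrix_matrix_mult)
  note mv = bounded_bilinear_matrix_vector_mult
  let ?g = "\<lambda>\<tau>. A *v x \<tau>"
  have "set_integrable lebesgue {0..t} (\<lambda>\<tau>. A *v x \<tau> + \<alpha> \<tau> *\<^sub>R (B *v u \<tau>))"
    using traj by (simp add: is_trajectory_def)
  also have "?this \<longleftrightarrow> set_integrable lebesgue {0..t} ?g"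
    by (rule set_integrable_cong) (auto simp: \<alpha>)
  finally have int: "set_integrable lebesgue {0..t} ?g" .
  have x: "x s = integral {0..s} ?g" if s: "s \<in> {0..t}" for s
  proof -
    have "x s = (LINT \<tau>:{0..s}|lebesgue. A *v x \<tau> + \<alpha> \<tau> *\<^sub>R (B *v u \<tau>))"
      using traj s x0 unfolding is_trajectory_def by auto
    also have "\<dots> = (LINT \<tau>:{0..s}|lebesgue. ?g \<tau>)"
      by (rule set_lebesgue_integral_cong) (use s \<alpha> in auto)
    also have "\<dots> = integral {0..s} ?g"
      by (rule set_lebesgue_integral_eq_integral(2), rule set_integrable_subset[OF int]) (use s in auto)
    finally show ?thesis .
  qed
  \<comment> \<open>Regularity is bootstrapped: an indefinite integral is continuous, so the
    integrand \<open>A *v x \<tau>\<close> is continuous, and \<open>x\<close> is then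
    differentiable.\<close>
  have contx: "continuous_on {0..t} x"
    by (rule continuous_on_eq[where f = "\<lambda>s. integral {0..s} ?g"])
      (auto simp: x intro: indefinite_integral_continuous_1 set_lebesgue_integral_eq_integral(1)[OF int])
  have contAx: "continuous_on {0..t} ?g"
    by (intro bounded_bilinear.continuous_on[OF mv] contx continuous_on_const)
  have x': "(x has_vector_derivative A *v x s) (at s within {0..t})" if "s \<in> {0..t}" for s
    by (rule has_vector_derivative_transform[OF that _ integral_has_vector_derivative[OF contAx that]])
      (simp add: x)
  have "((\<lambda>s. mexp (- A) s *v x s) has_vector_derivative 0) (at s within {0..t})"
    if s: "s \<in> {0..t}" for s
  proof -
    have "((\<lambda>s. mexp (- A) s *v x s) has_vector_derivative
       mexp (- A) s *v (A *v x s) + (- A ** mexp (- A) s) *v x s) (at s within {0..t})"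
      by (rule bounded_bilinear.has_vector_derivative[OF mv mexp_deriv x'[OF s]])
    also have "(- A ** mexp (- A) s) *v x s = - (mexp (- A) s *v (A *v x s))"
      unfolding mexp_commute[of "- A" s, symmetric]
      by (simp add: mm.minus_right bounded_bilinear.minus_left[OF mv] matrix_vector_mul_assoc)
    finally show ?thesis by simp
  qed
  then obtain k where k: "\<And>s. s \<in> {0..t} \<Longrightarrow> mexp (- A) s *v x s = k"
    using has_vector_derivative_zero_constant[of "{0..t}" "\<lambda>s. mexp (- A) s *v x s"] by auto
  from k[of 0] k[of t] t x0 have "mexp (- A) t *v x t = 0"
    by simp
  then have "mexp A t *v (mexp (- A) t *v x t) = 0"
    by simp
  then show ?thesis
    by (simp add: matrix_vector_mul_assoc mexp_mult_minus)
qed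

text \<open>A window starting at s \<ge> 0 loses at most an initial piece of length T - \<mu>, and
  its last piece of length \<mu> lies where the signal is 1. The half-line is open so that the
  signal vanishes also at T - \<mu>, which covers the borderline time t = T - \<mu>.\<close>

lemma late_signal_in_pe_signals:
  assumes "0 < \<mu>" "\<mu> \<le> T"
  shows "indicator {T - \<mu><..} \<in> pe_signals T \<mu>"
proof -
  have "\<mu> \<le> (LINT \<tau>:{s..s+T}|lebesgue. indicator {T - \<mu><..} \<tau>)" if "0 \<le> s" for s :: real
  proof -
    have "\<mu> = measure lebesgue {s + (T - \<mu>)<..s + T}"
      using assms by simp
    also have "\<dots> \<le> measure lebesgue ({s..s+T} \<inter> {T - \<mu><..})"
    proof (rule measure_mono_fmeasurable)
      show "{s..s+T} \<inter> {T - \<mu><..} \<in> lmeasurable"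
        by (intro fmeasurable_Int_fmeasurable) auto
    qed (use that assms in auto)
    also have "\<dots> = (LINT \<tau>:{s..s+T}|lebesgue. indicator {T - \<mu><..} \<tau>)"
      by (simp add: set_lebesgue_integral_def flip: indicator_inter_arith)
    finally show ?thesis .
  qed
  moreover have "set_borel_measurable lebesgue {0..} (indicator {T - \<mu><..} :: real \<Rightarrow> real)"
    by (simp add: set_borel_measurable_def borel_measurable_indicator flip: indicator_inter_arith)
  moreover have "indicator {T - \<mu><..} s \<in> {0..1::real}" for s
    by (simp add: indicator_def)
  ultimately show ?thesis
    by (simp add: pe_signals_def)
qed

text \<open>The window starting at 0 decides: a signal vanishing on [0, t] and bounded by 1 has
  integral over [0, T] at most the length of [t, T], which is below \<mu>.\<close>

lemma pe_signal_not_AE_zero: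
  assumes \<mu>: "0 < \<mu>" "\<mu> \<le> T" and t: "T - \<mu> < t" "0 < t" and \<alpha>: "\<alpha> \<in> pe_signals T \<mu>"
  shows "\<not> (AE s in lebesgue. s \<in> {0..t} \<longrightarrow> \<alpha> s = 0)"
proof
  assume ae: "AE s in lebesgue. s \<in> {0..t} \<longrightarrow> \<alpha> s = 0"
  have m: "set_borel_measurable lebesgue {0..T} \<alpha>"
    using \<alpha> by (auto simp: pe_signals_def intro: set_borel_measurable_subset)
  then have "(\<lambda>s. \<alpha> s *\<^sub>R (1::real)) absolutely_integrable_on {0..T}"
    by (intro absolutely_integrable_signal_scaleR)
      (use \<alpha> in \<open>auto simp: pe_signals_def set_borel_measurable_def borel_measurable_restrict_space_iff\<close>)
  then have int: "set_integrable lebesgue {0..T} \<alpha>"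
    by simp
  have "\<mu> \<le> (LINT \<tau>:{0..T}|lebesgue. \<alpha> \<tau>)"
    using \<alpha> by (force simp: pe_signals_def)
  also have "\<dots> \<le> (LINT \<tau>:{0..T}|lebesgue. indicator {t..} \<tau>)"
  proof (rule set_integral_mono_AE)
    show "AE s\<in>{0..T} in lebesgue. \<alpha> s \<le> indicator {t..} s"
      using ae by eventually_elim (use \<alpha> in \<open>auto simp: pe_signals_def indicator_def\<close>)
    have "{0..T} \<inter> {t..} \<in> lmeasurable"
      by (intro fmeasurable_Int_fmeasurable) auto
    then show "set_integrable lebesgue {0..T} (indicator {t..} :: real \<Rightarrow> real)"
      by (simp add: set_integrable_def fmeasurable_def less_top flip: indicator_inter_arith)
  qed (rule int)
  also have "\<dots> = measure lebesgue ({0..T} \<inter> {t..})"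
    by (simp add: set_lebesgue_integral_def flip: indicator_inter_arith)
  also have "{0..T} \<inter> {t..} = {t..T}" using t by auto
  \<comment> \<open>If t \<le> T the length is T - t < \<mu>; otherwise the interval is empty and
    the bound is 0 < \<mu>.\<close>
  also have "measure lebesgue {t..T} < \<mu>" using t \<mu> by simp
  finally show False by simp
qed

theorem proposition4:
  fixes A :: "real^'n^'n" and B :: "real^'m^'n" and T \<mu> t :: real
  assumes "0 < \<mu>" and "\<mu> \<le> T"
    and "controllable_pair A B"
    and "t > 0"
  shows "controllable_for_pe_signals A B T \<mu> t \<longleftrightarrow> t > T - \<mu>"
proof
  assume ctrl: "controllable_for_pe_signals A B T \<mu> t"
  show "t > T - \<mu>"
  proof (rule ccontr)
    assume "\<not> t > T - \<mu>"
    then have zero: "indicator {T - \<mu><..} s = (0::real)" if "s \<in> {0..t}" for s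
      using that by simp
    \<comment> \<open>Here \<open>1\<close> is the vector with all entries 1, a nonzero target that
      cannot be reached from the origin without input.\<close>
    obtain u x where "is_trajectory A B (indicator {T - \<mu><..}) t u x" "x 0 = 0" "x t = 1"
      using ctrl late_signal_in_pe_signals[OF assms(1,2)]
      unfolding controllable_for_pe_signals_def completely_controllable_def by blast
    with uncontrolled_trajectory_zero[OF this(1) zero this(2) assms(4)] show False
      by (simp add: vec_eq_iff)
  qed
next
  assume t: "t > T - \<mu>"
  show "controllable_for_pe_signals A B T \<mu> t"
    unfolding controllable_for_pe_signals_def
  proof
    fix \<alpha> assume \<alpha>: "\<alpha> \<in> pe_signals T \<mu>"
    then have "set_borel_measurable lebesgue {0..t} \<alpha>"
      by (auto simp: pe_signals_def intro: set_borel_measurable_subset)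
    then have "\<alpha> \<in> borel_measurable (lebesgue_on {0..t})"
      by (simp add: set_borel_measurable_def borel_measurable_restrict_space_iff)
    then show "completely_controllable A B \<alpha> t"
      by (rule completely_controllableI[OF assms(3,4)])
        (use \<alpha> pe_signal_not_AE_zero[OF assms(1,2) t assms(4) \<alpha>] in \<open>auto simp: pe_signals_def\<close>)
  qed
qed

end
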